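(* Let $f\in C^2(\mathbb{R})$ be strictly concave and let $h:\mathbb{R}\to\mathbb{R}$ be a piecewise $C^1$-function with compact support. Let $u,v\in\Upsilon(f,h)$ be two solutions of the integral form of the conservation law $$\frac{d}{dt}\int_a^b u(x,t)\,dx=f(u(a,t))-f(u(b,t))$$ with the properties (a) $u^-<u^+$ and $v^-<v^+$ at every shock of $u$ and of $v$, respectively, and (b) $u(x,0)=v(x,0)$ for all $x\in\mathbb{R}$. Then the $L^1(\mathbb{R})$-norm satisfies $\|u(\cdot,t)-v(\cdot,t)\|_1=0$ for all $t>0$.
   Context: **Bounding characteristic surface.** For $t\ge 0$ let $G_t(x,y):=(x+f'(y)t,\;y)$, a map $\mathbb{R}^2\to\mathbb{R}^2$. Let $\gamma_0\subset\mathbb{R}^2$ be the graph of $h$ together with the vertical line segments joining its discontinuities (a continuous curve), and let $\gamma_t:=G_t(\gamma_0)$. The bounding characteristic surface is $\hat\Gamma:=\{(x,t,y)\mid (x,y)\in\gamma_t,\ t\ge 0\}\subset\mathbb{R}^3$. **Class $\Upsilon=\Upsilon(f,h)$.** Here $f\in C^2(\mathbb{R})$ and $h$ is a piecewise $C^1$-function with compact support. A function $u$ belongs to $\Upsilon(f,h)$ if: (i) $u=u(x,t)$ is a real function defined everywhere on $\mathbb{R}\times[0,\infty)$; (ii) $u(x,0)=h(x)$ for all $x\in\mathbb{R}$; (iii) the graph $\{(x,t,u(x,t))\}$ is a subset of $\hat\Gamma$; (iv) the boundary of the graph of $u$ is a finite union of $C^1$-curves, and the projections of these curves on the $(x,t)$-plane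 intersect any line $t=t_0$ only finitely many times; (v) $\int_{-\infty}^{\infty}u(x,t)\,dx$ is a continuous function of $t$ for $t\ge 0$. **Solution of the integral form.** $u$ is a solution of the integral form if the displayed identity holds for all $a<b$ and $t>0$ for which $u$ is continuous at $(a,t)$ and $(b,t)$. **Shocks.** The discontinuities of $u\in\Upsilon$ for $t>0$ are called shocks; they are positioned along piecewise smooth curves $x=s(t)$ in the $(x,t)$-plane, called shock paths. There are finitely many of them and they are locally smooth; singular points of shock paths (including points where they cross or collide) are disregarded, i.e. conditions at shocks, and the identity in the integral form, are considered away from such points. At a shock $(x_0,t)$ put $u^+=\lim_{x\searrow x_0}u(x,t)$ and $u^-=\lim_{x\nearrow x_0}u(x,t)$; similarly for $v$. *)

theory Defs
  imports "HOL-Analysis.Analysis"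
begin

definition C2 :: "(real \<Rightarrow> real) \<Rightarrow> bool" where
  "C2 f \<longleftrightarrow> f differentiable_on UNIV \<and> deriv f differentiable_on UNIV \<and>
     continuous_on UNIV (deriv (deriv f))"

definition strictly_concave :: "(real \<Rightarrow> real) \<Rightarrow> bool" where
  "strictly_concave f \<longleftrightarrow>
     (\<forall>x y \<mu>. x \<noteq> y \<and> 0 < \<mu> \<and> \<mu> < 1 \<longrightarrow>
        (1 - \<mu>) * f x + \<mu> * f y < f ((1 - \<mu>) * x + \<mu> * y))"

text \<open>
  Jumps are allowed, so this differs from \<^const>\<open>piecewise_C1_differentiable_on\<close>, which demands
  continuity. On each piece the function and its derivative extend continuously to the end points;
  the value at a break point is arbitrary.
\<close>

definition piecewise_C1 :: "(real \<Rightarrow> real) \<Rightarrow> bool" where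
  "piecewise_C1 h \<longleftrightarrow>
     (\<exists>S. finite S \<and> h C1_differentiable_on (- S) \<and>
        (\<forall>x\<in>S. \<forall>F\<in>{at_left x, at_right x}.
           (\<exists>l. (h \<longlongrightarrow> l) F) \<and> (\<exists>l. (deriv h \<longlongrightarrow> l) F)))"

definition compactly_supported :: "(real \<Rightarrow> real) \<Rightarrow> bool" where
  "compactly_supported h \<longleftrightarrow> compact (closure (support_on UNIV h))"

definition char_map :: "(real \<Rightarrow> real) \<Rightarrow> real \<Rightarrow> real \<times> real \<Rightarrow> real \<times> real" where
  "char_map f t = (\<lambda>(x, y). (x + deriv f y * t, y))"

text \<open>
  The vertical segment at a jump is the hull of the two one-sided limits together with the value of
  \<open>h\<close>. If that value lies between the limits, this is the segment joining them; including it keeps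
  the set connected in general.
\<close>

definition initial_curve :: "(real \<Rightarrow> real) \<Rightarrow> (real \<times> real) set" where
  "initial_curve h =
     {(x, h x) | x. True} \<union>
     {(x, y) | x y. \<not> isCont h x \<and>
        y \<in> convex hull {Lim (at_left x) h, h x, Lim (at_right x) h}}"

definition char_curve :: "(real \<Rightarrow> real) \<Rightarrow> (real \<Rightarrow> real) \<Rightarrow> real \<Rightarrow> (real \<times> real) set" where
  "char_curve f h t = char_map f t ` initial_curve h"

definition char_surface :: "(real \<Rightarrow> real) \<Rightarrow> (real \<Rightarrow> real) \<Rightarrow> (real \<times> real \<times> real) set" where
  "char_surface f h = {(x, t, y) | x t y. (x, y) \<in> char_curve f h t \<and> t \<ge> 0}"

text \<open>
  A function on the closed half plane \<open>t \<ge> 0\<close> is a curried total function \<open>u x t\<close>; nothing below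
  depends on its values for \<open>t < 0\<close>.
\<close>

definition graph_of :: "(real \<Rightarrow> real \<Rightarrow> real) \<Rightarrow> (real \<times> real \<times> real) set" where
  "graph_of u = {(x, t, u x t) | x t. t \<ge> 0}"

text \<open>
  The graph is regarded as a piece of the characteristic surface, so its boundary is the frontier
  relative to that surface. (The frontier in the ambient three-space would contain the whole graph.)
\<close>

definition graph_boundary ::
  "(real \<Rightarrow> real) \<Rightarrow> (real \<Rightarrow> real) \<Rightarrow> (real \<Rightarrow> real \<Rightarrow> real) \<Rightarrow> (real \<times> real \<times> real) set" where
  "graph_boundary f h u = top_of_set (char_surface f h) frontier_of graph_of u"

text \<open>
  The parameter interval may be open, closed, unbounded or degenerate; at an included end point the
  derivative is one-sided.
\<close>

definition C1_curve :: "'a::real_normed_vector set \<Rightarrow> bool" where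
  "C1_curve C \<longleftrightarrow>
     (\<exists>(I :: real set) c c'. is_interval I \<and> C = c ` I \<and>
        (\<forall>\<tau>\<in>I. (c has_vector_derivative c' \<tau>) (at \<tau> within I)) \<and> continuous_on I c')"

definition Upsilon :: "(real \<Rightarrow> real) \<Rightarrow> (real \<Rightarrow> real) \<Rightarrow> (real \<Rightarrow> real \<Rightarrow> real) set" where
  "Upsilon f h = {u.
     (\<forall>x. u x 0 = h x) \<and>
     graph_of u \<subseteq> char_surface f h \<and>
     (\<exists>\<C>. finite \<C> \<and> graph_boundary f h u = \<Union>\<C> \<and>
        (\<forall>C\<in>\<C>. C1_curve C \<and> (\<forall>t0. finite {x. \<exists>y. (x, t0, y) \<in> C}))) \<and>
     (\<forall>t\<ge>0. integrable lborel (\<lambda>x. u x t)) \<and>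
     continuous_on {0..} (\<lambda>t. LINT x|lborel. u x t)}"

definition continuous_at_point :: "(real \<Rightarrow> real \<Rightarrow> real) \<Rightarrow> real \<Rightarrow> real \<Rightarrow> bool" where
  "continuous_at_point u x t \<longleftrightarrow> isCont (\<lambda>(x, t). u x t) (x, t)"

definition shocks :: "(real \<Rightarrow> real \<Rightarrow> real) \<Rightarrow> (real \<times> real) set" where
  "shocks u = {(x, t). t > 0 \<and> \<not> continuous_at_point u x t}"

text \<open>
  A shock is regular if, near it, the shock set is a single \<open>C\<^sup>1\<close> path \<open>x = s t\<close> running through it.
  All others are singular: corners, end points, crossings, collisions.
\<close>

definition regular_shocks :: "(real \<Rightarrow> real \<Rightarrow> real) \<Rightarrow> (real \<times> real) set" where
  "regular_shocks u = {(x0, t0) \<in> shocks u.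
     \<exists>s. \<exists>\<delta>>0. s C1_differentiable_on {t0 - \<delta><..<t0 + \<delta>} \<and>
       (\<forall>x t. \<bar>x - x0\<bar> < \<delta> \<and> \<bar>t - t0\<bar> < \<delta> \<longrightarrow> ((x, t) \<in> shocks u \<longleftrightarrow> x = s t))}"

definition singular_shocks :: "(real \<Rightarrow> real \<Rightarrow> real) \<Rightarrow> (real \<times> real) set" where
  "singular_shocks u = shocks u - regular_shocks u"

text \<open>
  The standing assumption on shocks: they lie on finitely many piecewise smooth paths, and only
  finitely many of them are singular up to any given time, so that disregarding the singular ones
  makes sense.
\<close>

definition piecewise_smooth_shocks :: "(real \<Rightarrow> real \<Rightarrow> real) \<Rightarrow> bool" where
  "piecewise_smooth_shocks u \<longleftrightarrow>
     (\<exists>P :: (real set \<times> (real \<Rightarrow> real)) set. finite P \<and>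
        (\<forall>(I, s)\<in>P. is_interval I \<and> I \<subseteq> {0<..} \<and> s piecewise_C1_differentiable_on I) \<and>
        shocks u \<subseteq> (\<Union>(I, s)\<in>P. (\<lambda>t. (s t, t)) ` I)) \<and>
     (\<forall>T. finite {(x, t) \<in> singular_shocks u. t \<le> T})"

definition increasing_shocks :: "(real \<Rightarrow> real \<Rightarrow> real) \<Rightarrow> bool" where
  "increasing_shocks u \<longleftrightarrow>
     (\<forall>(x0, t)\<in>regular_shocks u.
        \<exists>um up. ((\<lambda>x. u x t) \<longlongrightarrow> um) (at_left x0) \<and> ((\<lambda>x. u x t) \<longlongrightarrow> up) (at_right x0) \<and> um < up)"

definition integral_form_solution :: "(real \<Rightarrow> real) \<Rightarrow> (real \<Rightarrow> real \<Rightarrow> real) \<Rightarrow> bool" where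
  "integral_form_solution f u \<longleftrightarrow>
     (\<forall>a b t. a < b \<and> t > 0 \<and> continuous_at_point u a t \<and> continuous_at_point u b t \<and>
        singular_shocks u \<inter> {a..b} \<times> {t} = {} \<longrightarrow>
        ((\<lambda>\<tau>. LINT x:{a..b}|lborel. u x \<tau>) has_real_derivative f (u a t) - f (u b t)) (at t))"

definition L1_norm :: "(real \<Rightarrow> real) \<Rightarrow> ennreal" where
  "L1_norm g = (\<integral>\<^sup>+x. ennreal \<bar>g x\<bar> \<partial>lborel)"

end

(*
  Let U(x,t) be the primitive of u(.,t) from -infinity, and V that of v. Away from shocks U solves
  the Hamilton-Jacobi equation U_t + f(U_x) = f(0), and the condition u^- < u^+ says that U has
  convex kinks at shocks. Concavity of f gives the Hopf-Lax lower bound for the increments of V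
  along every line of slope f'(p); U attains it to first order along its own backward
  characteristics. Consider the maximum over x and y of U(x,t) - V(y,t) - M (x-y)^2 - lam t as a
  function of t. At a maximal point (x,y) the kink keeps x away from the shocks of u, and moving both
  points back along the characteristic of u contradicts the Hopf-Lax bound if the maximum has grown.
  Hence U <= V, by symmetry U = V, and u = v off the finitely many shocks at each time.
*)

theory Submission
  imports Defs
begin

section \<open>Real functions with countable exceptional sets\<close>

text \<open>The complement \<open>D\<close> of the accumulation points is open, \<open>E\<close> is
  sparse in \<open>D\<close>, and sparse subsets of open sets are countable. Used in contrapositive
  form: an uncountable set of reals contains one of its own limit points.\<close>

lemma countable_if_isolated:
  fixes E :: "real set"
  assumes "\<And>x. x \<in> E \<Longrightarrow> \<not> x islimpt E"
  shows "countable E"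
proof -
  define D where "D = - {x. x islimpt E}"
  have "open D" unfolding D_def by (intro open_Compl closed_limpts)
  have "E sparse_in D"
    unfolding sparse_in_open[OF \<open>open D\<close>] by (simp add: D_def)
  then have "countable (D \<inter> E)"
    by (rule sparse_imp_countable[OF \<open>open D\<close>])
  moreover have "D \<inter> E = E" using assms unfolding D_def by auto
  ultimately show ?thesis by simp
qed

text \<open>The one-dimensional Sard theorem. \<open>baby_Sard\<close> speaks of Cartesian powers of
  \<open>real\<close>, so \<open>g\<close> is carried over to a self-map \<open>G\<close> of
  \<open>real^1\<close>, whose zero derivative has a matrix of rank 0.\<close>

lemma negligible_critical_values:
  fixes g :: "real \<Rightarrow> real"
  assumes "\<And>t. t \<in> D \<Longrightarrow> (g has_real_derivative 0) (at t)"
  shows "negligible (g ` D)"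
proof -
  define G :: "real^1 \<Rightarrow> real^1" where "G = (\<lambda>z. g (z $ 1) *\<^sub>R vec 1)"
  define D' :: "(real^1) set" where "D' = {z. z $ 1 \<in> D}"
  have "negligible (G ` D')"
  proof (rule baby_Sard)
    fix z assume z: "z \<in> D'"
    have "(g has_derivative (\<lambda>_. 0)) (at (z $ 1))"
      using assms[of "z $ 1"] z unfolding D'_def has_field_derivative_def
      by (simp add: lambda_zero)
    from has_derivative_compose[OF has_derivative_at_withinI[OF bounded_linear_imp_has_derivative[OF bounded_linear_vec_nth]] this]
    have "((\<lambda>z. g (z $ 1)) has_derivative (\<lambda>_. 0)) (at z within D')" .
    from has_derivative_scaleR_left[OF this, of "vec 1"]
    show "(G has_derivative (\<lambda>_. 0)) (at z within D')" unfolding G_def by simp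
    have "matrix (\<lambda>_::real^1. 0::real^1) = 0"
      by (simp add: matrix_def vec_eq_iff)
    then show "rank (matrix (\<lambda>_::real^1. 0::real^1)) < CARD(1)"
      by (simp add: rank_eq_0)
  qed simp
  then have "negligible ((\<lambda>z. z $ 1) ` (G ` D'))"
    by (rule negligible_differentiable_image_negligible[rotated])
       (auto intro!: bounded_linear_imp_differentiable_on bounded_linear_vec_nth)
  moreover have "g ` D \<subseteq> (\<lambda>z. z $ 1) ` (G ` D')"
  proof
    fix c assume "c \<in> g ` D"
    then obtain t where "t \<in> D" "c = g t" by auto
    then show "c \<in> (\<lambda>z. z $ 1) ` (G ` D')"
      by (intro image_eqI[of _ _ "G (vec t)"] image_eqI[of _ _ "vec t"]) (auto simp: G_def D'_def)
  qed
  ultimately show ?thesis by (rule negligible_subset)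
qed

text \<open>An uncountable fibre accumulates at one of its points \<open>t\<close>. The difference
  quotients at \<open>t\<close> vanish along the fibre, so the derivative there is 0 and
  \<open>c\<close> is a critical value.\<close>

lemma negligible_uncountable_fibres:
  fixes g :: "real \<Rightarrow> real"
  assumes "\<And>t. t \<in> D \<Longrightarrow> g differentiable (at t)"
  shows "negligible {c. uncountable {t \<in> D. g t = c}}"
proof -
  define Z where "Z = {t \<in> D. (g has_real_derivative 0) (at t)}"
  have "{c. uncountable {t \<in> D. g t = c}} \<subseteq> g ` Z"
  proof
    fix c assume "c \<in> {c. uncountable {t \<in> D. g t = c}}"
    then obtain t where "t \<in> {t \<in> D. g t = c}" and lim: "t islimpt {t \<in> D. g t = c}"
      using countable_if_isolated[of "{t \<in> D. g t = c}"] by blast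
    then have t: "t \<in> D" "g t = c" by auto
    obtain d where d: "(g has_real_derivative d) (at t)"
      using assms[OF t(1)] by (auto simp: real_differentiable_def)
    have "d = 0"
    proof (rule ccontr)
      assume "d \<noteq> 0"
      have "((\<lambda>y. (g y - g t) / (y - t)) \<longlongrightarrow> d) (at t)"
        using d by (simp add: has_field_derivative_iff)
      then have "\<forall>\<^sub>F y in at t. (g y - g t) / (y - t) \<noteq> 0"
        using \<open>d \<noteq> 0\<close> by (rule tendsto_imp_eventually_ne)
      then have "\<forall>\<^sub>F y in at t. g y \<noteq> c"
        by eventually_elim (use t in auto)
      then have "\<forall>\<^sub>F y in at t. y \<notin> {t \<in> D. g t = c}" by (rule eventually_mono) simp
      then show False using lim unfolding islimpt_iff_eventually by contradiction
    qed
    then show "c \<in> g ` Z" using t d unfolding Z_def by auto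
  qed
  moreover have "negligible (g ` Z)"
    by (rule negligible_critical_values) (auto simp: Z_def)
  ultimately show ?thesis by (rule negligible_subset[rotated])
qed

text \<open>
  The first time at which \<open>k\<close> reaches a level outside the countable set \<open>k ` E\<close> is not in \<open>E\<close>.
\<close>

lemma nonincreasing_off_countable:
  fixes k :: "real \<Rightarrow> real"
  assumes "a \<le> b" and cont: "continuous_on {a..b} k" and "countable E"
    and step: "\<And>t. a < t \<Longrightarrow> t \<le> b \<Longrightarrow> t \<notin> E \<Longrightarrow> \<exists>s. a \<le> s \<and> s < t \<and> k t \<le> k s"
  shows "k b \<le> k a"
proof (rule ccontr)
  assume "\<not> k b \<le> k a"
  then have "uncountable {k a<..<k b}" by (simp add: uncountable_open_interval)
  then have "uncountable ({k a<..<k b} - k ` E)"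
    using \<open>countable E\<close> by (intro uncountable_minus_countable) auto
  then have "{k a<..<k b} - k ` E \<noteq> {}" by (metis countable_empty)
  then obtain l where "l \<in> {k a<..<k b} - k ` E" by blast
  then have l: "k a < l" "l < k b" "l \<notin> k ` E" by auto
  define T where "T = {a..b} \<inter> k -` {l}"
  have "\<exists>t\<ge>a. t \<le> b \<and> k t = l"
    using l by (intro IVT' \<open>a \<le> b\<close> cont) auto
  then have "T \<noteq> {}" unfolding T_def by auto
  have "closed T"
    unfolding T_def using cont by (rule continuous_closed_preimage) auto
  then have "compact T"
    using compact_Int_closed[OF compact_Icc \<open>closed T\<close>, of a b] by (simp add: T_def)
  then obtain t where t: "t \<in> T" and least: "\<And>s. s \<in> T \<Longrightarrow> t \<le> s"
    using compact_attains_inf[OF _ \<open>T \<noteq> {}\<close>] by blast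
  have "a < t" "t \<le> b" "t \<notin> E" using t l unfolding T_def by (auto simp: less_eq_real_def)
  \<comment> \<open>Stepping back from the first hitting time stays at or above level
    \<open>l\<close>, so \<open>k\<close> already takes the value \<open>l\<close> in
    \<open>[a, s]\<close>, which is too early.\<close>
  from step[OF this] obtain s where s: "a \<le> s" "s < t" "l \<le> k s" using t unfolding T_def by auto
  have "continuous_on {a..s} k" by (rule continuous_on_subset[OF cont]) (use s \<open>t \<le> b\<close> in auto)
  then have "\<exists>r\<ge>a. r \<le> s \<and> k r = l"
    using l s by (intro IVT') auto
  then obtain r where "a \<le> r" "r \<le> s" "k r = l" by blast
  then have "r \<in> T" using s \<open>t \<le> b\<close> unfolding T_def by auto
  then show False using least[of r] \<open>r \<le> s\<close> s by auto
qed

text \<open>A mean value inequality tolerating countably many exceptional times. Lowering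
  \<open>m\<close> to \<open>m - e\<close> gives \<open>q\<close> a strictly negative derivative at
  good times, hence the earlier, larger value demanded by
  \<open>nonincreasing_off_countable\<close>; then \<open>e\<close> tends to 0.\<close>

lemma increment_ge_off_countable:
  fixes k :: "real \<Rightarrow> real"
  assumes "a \<le> b" and cont: "continuous_on {a..b} k" and "countable E"
    and der: "\<And>t. a < t \<Longrightarrow> t \<le> b \<Longrightarrow> t \<notin> E \<Longrightarrow> \<exists>d\<ge>m. (k has_real_derivative d) (at t)"
  shows "m * (b - a) \<le> k b - k a"
proof -
  have "(m - e) * (b - a) \<le> k b - k a" if "e > 0" for e
  proof -
    define q where "q = (\<lambda>t. (m - e) * t - k t)"
    have "q b \<le> q a"
    proof (rule nonincreasing_off_countable[OF \<open>a \<le> b\<close> _ \<open>countable E\<close>])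
      show "continuous_on {a..b} q" unfolding q_def by (intro continuous_intros cont)
    next
      fix t assume t: "a < t" "t \<le> b" "t \<notin> E"
      then obtain d where d: "d \<ge> m" "(k has_real_derivative d) (at t)" using der by blast
      have "(q has_real_derivative (m - e) - d) (at t)"
        unfolding q_def by (auto intro!: derivative_eq_intros d(2))
      from DERIV_neg_dec_left[OF this] d(1) \<open>e > 0\<close>
      obtain r where r: "r > 0" "\<And>h. h > 0 \<Longrightarrow> h < r \<Longrightarrow> q t < q (t - h)" by auto
      define h where "h = min (r / 2) (t - a)"
      have "h > 0" "h < r" "a \<le> t - h" using r(1) t unfolding h_def by auto
      then show "\<exists>s. a \<le> s \<and> s < t \<and> q t \<le> q s"
        using r(2)[of h] by (intro exI[of _ "t - h"]) auto
    qed
    then show ?thesis unfolding q_def by (simp add: algebra_simps)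
  qed
  then have "\<And>e. e > 0 \<Longrightarrow> m * (b - a) \<le> (k b - k a) + e * (b - a)"
    by (simp add: algebra_simps)
  show ?thesis
  proof (cases "a = b")
    case False
    show ?thesis
    proof (rule field_le_epsilon)
      fix e :: real assume "e > 0"
      with \<open>\<And>e. e > 0 \<Longrightarrow> m * (b - a) \<le> (k b - k a) + e * (b - a)\<close>[of "e / (b - a)"] False \<open>a \<le> b\<close>
      show "m * (b - a) \<le> k b - k a + e" by simp
    qed
  qed simp
qed

section \<open>The concave flux and bounds on the initial curve\<close>

lemma C2_deriv:
  assumes "C2 f"
  shows "(f has_real_derivative deriv f y) (at y)"
proof -
  have "f differentiable (at y)"
    using assms unfolding C2_def differentiable_on_def by simp
  then show ?thesis by (simp only: DERIV_deriv_iff_real_differentiable)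
qed

text \<open>Concavity enters the comparison argument through this tangent bound, which is the
  convexity inequality for \<open>- f\<close>.\<close>

lemma strictly_concave_below_tangent:
  assumes "C2 f" "strictly_concave f"
  shows "f q \<le> f p + deriv f p * (q - p)"
proof -
  have "convex_on UNIV (\<lambda>x. - f x)"
  proof (rule convex_onI)
    fix t x y :: real assume t: "0 < t" "t < 1"
    show "- f ((1 - t) *\<^sub>R x + t *\<^sub>R y) \<le> (1 - t) * - f x + t * - f y"
    proof (cases "x = y")
      case True
      then show ?thesis by (simp add: algebra_simps)
    next
      case False
      with assms(2) t have "(1 - t) * f x + t * f y < f ((1 - t) * x + t * y)"
        unfolding strictly_concave_def by blast
      then show ?thesis by simp
    qed
  qed simp
  from convex_on_imp_above_tangent[OF this, of p q "- deriv f p"] C2_deriv[OF assms(1), of p]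
  show ?thesis by (auto intro!: derivative_eq_intros simp: algebra_simps)
qed

text \<open>One-sided limits exist at break points by definition and elsewhere by continuity. Hence
  the \<open>Lim\<close> terms in \<open>initial_curve\<close> are genuine limits and not
  unspecified values.\<close>

lemma piecewise_C1_limits:
  assumes "piecewise_C1 h"
  shows piecewise_C1_finite_discontinuities: "finite {x. \<not> isCont h x}"
    and piecewise_C1_left_limit: "(h \<longlongrightarrow> Lim (at_left x) h) (at_left x)"
    and piecewise_C1_right_limit: "(h \<longlongrightarrow> Lim (at_right x) h) (at_right x)"
proof -
  obtain S where S: "finite S" "h C1_differentiable_on (- S)"
    "\<And>x F. x \<in> S \<Longrightarrow> F \<in> {at_left x, at_right x} \<Longrightarrow> \<exists>l. (h \<longlongrightarrow> l) F"
    using assms unfolding piecewise_C1_def by blast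
  have cont: "isCont h x" if "x \<notin> S" for x
    using S(2) that unfolding C1_differentiable_on_eq
    by (auto intro: differentiable_imp_continuous_within)
  show "finite {x. \<not> isCont h x}" 
    using cont by (auto intro: finite_subset[OF _ S(1)])
  have "\<exists>l. (h \<longlongrightarrow> l) F" if "F \<in> {at_left x, at_right x}" for F
  proof (cases "x \<in> S")
    case False
    then have "(h \<longlongrightarrow> h x) (at x)" using cont by (simp add: isCont_def)
    then show ?thesis using that by (auto simp: filterlim_at_split)
  qed (use S(3) that in blast)
  then obtain l r where "(h \<longlongrightarrow> l) (at_left x)" "(h \<longlongrightarrow> r) (at_right x)" by blast
  then show "(h \<longlongrightarrow> Lim (at_left x) h) (at_left x)" "(h \<longlongrightarrow> Lim (at_right x) h) (at_right x)"
    using tendsto_Lim[of "at_left x" h l] tendsto_Lim[of "at_right x" h r] by auto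
qed

text \<open>A closed convex set containing the values of \<open>h\<close> near \<open>x\<close>
  contains the one-sided limits and so the whole vertical segment. Every estimate for
  \<open>h\<close> is transferred to \<open>initial_curve\<close> in this way.\<close>

lemma initial_curve_near:
  assumes "piecewise_C1 h" and "(x, y) \<in> initial_curve h" and "open X" "x \<in> X"
    and "closed C" "convex C" "h ` X \<subseteq> C"
  shows "y \<in> C"
proof -
  have ev: "\<forall>\<^sub>F z in at x. h z \<in> C"
    using eventually_at_in_open'[OF assms(3,4)] by eventually_elim (use assms in auto)
  then have "\<forall>\<^sub>F z in at_left x. h z \<in> C" "\<forall>\<^sub>F z in at_right x. h z \<in> C"
    by (auto simp: eventually_at_split)
  then have "Lim (at_left x) h \<in> C" "Lim (at_right x) h \<in> C"
    using piecewise_C1_left_limit[OF assms(1), of x] piecewise_C1_right_limit[OF assms(1), of x]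
    by (auto intro: Lim_in_closed_set[OF \<open>closed C\<close>])
  moreover have "h x \<in> C" using assms by auto
  ultimately have "convex hull {Lim (at_left x) h, h x, Lim (at_right x) h} \<subseteq> C"
    using \<open>convex C\<close> by (intro hull_minimal) auto
  then show ?thesis using assms(2) \<open>h x \<in> C\<close> unfolding initial_curve_def by auto
qed

text \<open>The one-sided limits bound \<open>h\<close> near each point, jumps included, and
  finitely many such neighbourhoods cover the support.\<close>

lemma piecewise_C1_bounded:
  assumes "piecewise_C1 h" "compactly_supported h"
  shows "\<exists>K. \<forall>x. \<bar>h x\<bar> \<le> K"
proof -
  have loc: "\<exists>X M. open X \<and> x \<in> X \<and> (\<forall>z\<in>X. \<bar>h z\<bar> \<le> M)" for x
  proof -
    have "\<forall>\<^sub>F z in at_left x. \<bar>h z\<bar> < \<bar>Lim (at_left x) h\<bar> + 1"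
      by (rule order_tendstoD[OF tendsto_rabs[OF piecewise_C1_left_limit[OF assms(1)]]]) simp
    moreover have "\<forall>\<^sub>F z in at_right x. \<bar>h z\<bar> < \<bar>Lim (at_right x) h\<bar> + 1"
      by (rule order_tendstoD[OF tendsto_rabs[OF piecewise_C1_right_limit[OF assms(1)]]]) simp
    \<comment> \<open>The term \<open>\<bar>h x\<bar>\<close> is included because the one-sided
      filters do not see \<open>x\<close> itself.\<close>
    moreover define M where "M = max \<bar>h x\<bar> (max (\<bar>Lim (at_left x) h\<bar> + 1) (\<bar>Lim (at_right x) h\<bar> + 1))"
    ultimately have "\<forall>\<^sub>F z in at x. \<bar>h z\<bar> \<le> M"
      unfolding eventually_at_split by (auto elim!: eventually_mono simp: le_max_iff_disj)
    then obtain X where X: "open X" "x \<in> X" "\<forall>z\<in>X. z \<noteq> x \<longrightarrow> \<bar>h z\<bar> \<le> M"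
      unfolding eventually_at_topological by auto
    moreover have "\<bar>h x\<bar> \<le> M" unfolding M_def by simp
    ultimately show ?thesis by metis
  qed
  then obtain X M where XM: "\<And>x. open (X x)" "\<And>x. x \<in> X x" "\<And>x z. z \<in> X x \<Longrightarrow> \<bar>h z\<bar> \<le> M x"
    by metis
  define C where "C = closure (support_on UNIV h)"
  have "compact C" using assms(2) unfolding C_def compactly_supported_def .
  then obtain F where F: "finite F" "C \<subseteq> (\<Union>x\<in>F. X x)"
    by (rule compactE_image[of C C X]) (use XM in auto)
  show ?thesis
  proof (intro exI allI)
    fix x
    show "\<bar>h x\<bar> \<le> Max (insert 0 (M ` F))"
    proof (cases "x \<in> C")
      case True
      then obtain z where "z \<in> F" "x \<in> X z" using F by auto
      then have "\<bar>h x\<bar> \<le> M z" "M z \<in> insert 0 (M ` F)" using XM by auto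
      then show ?thesis using F(1) by (meson Max_ge finite.insertI finite_imageI order_trans)
    next
      case False
      then have "x \<notin> support_on UNIV h" unfolding C_def using closure_subset by (rule contra_subsetD[rotated])
      then have "h x = 0" by (simp add: support_on_def)
      then show ?thesis using F(1) by simp
    qed
  qed
qed

lemma initial_curve_bounded:
  assumes "piecewise_C1 h" "compactly_supported h"
  obtains K R where "\<And>x y. (x, y) \<in> initial_curve h \<Longrightarrow> \<bar>y\<bar> \<le> K"
    and "\<And>x y. (x, y) \<in> initial_curve h \<Longrightarrow> R < \<bar>x\<bar> \<Longrightarrow> y = 0"
proof -
  obtain K where K: "\<forall>x. \<bar>h x\<bar> \<le> K" using piecewise_C1_bounded[OF assms] ..
  have "bounded (support_on UNIV h)"
    using assms(2) unfolding compactly_supported_def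
    by (metis bounded_subset closure_subset compact_imp_bounded)
  then obtain R where R: "\<And>x. h x \<noteq> 0 \<Longrightarrow> \<bar>x\<bar> \<le> R"
    unfolding bounded_iff support_on_def by auto
  show thesis
  proof (rule that[of K R])
    fix x y assume xy: "(x, y) \<in> initial_curve h"
    have "h z \<in> {-K..K}" for z using K[rule_format, of z] unfolding atLeastAtMost_iff by linarith
    then have "y \<in> {-K..K}"
      by (intro initial_curve_near[OF assms(1) xy open_UNIV]) blast+
    then show "\<bar>y\<bar> \<le> K" by (simp add: abs_le_iff)
  next
    fix x y assume xy: "(x, y) \<in> initial_curve h"
    assume "R < \<bar>x\<bar>"
    have "open {z. R < \<bar>z\<bar>}" by (intro open_Collect_less continuous_intros)
    moreover have "h ` {z. R < \<bar>z\<bar>} \<subseteq> {0}" using R by fastforce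
    ultimately have "y \<in> {0}"
      using \<open>R < \<bar>x\<bar>\<close> by (intro initial_curve_near[OF assms(1) xy]) auto
    then show "y = 0" by simp
  qed
qed

section \<open>The spatial primitive of a bounded, compactly supported profile\<close>

definition primitive :: "(real \<Rightarrow> real \<Rightarrow> real) \<Rightarrow> real \<Rightarrow> real \<Rightarrow> real" where
  "primitive u x t = (LINT y:{..x}|lborel. u y t)"

text \<open>The support radius grows at speed at most \<open>L\<close>. The constants are parameters
  so that two solutions can share them.\<close>

locale bounded_profile =
  fixes u :: "real \<Rightarrow> real \<Rightarrow> real" and K R L :: real
  assumes integrable: "t \<ge> 0 \<Longrightarrow> integrable lborel (\<lambda>x. u x t)"
    and bound: "t \<ge> 0 \<Longrightarrow> \<bar>u x t\<bar> \<le> K"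
    and support: "t \<ge> 0 \<Longrightarrow> R + L * t < \<bar>x\<bar> \<Longrightarrow> u x t = 0"
    and L_nonneg: "L \<ge> 0"
begin

lemma set_integrable:
  "t \<ge> 0 \<Longrightarrow> A \<in> sets lborel \<Longrightarrow> set_integrable lborel A (\<lambda>y. u y t)"
  unfolding set_integrable_def using integrable integrable_mult_indicator by blast

lemma primitive_diff:
  assumes "t \<ge> 0" "a \<le> b"
  shows primitive_diff_open: "primitive u b t - primitive u a t = (LINT y:{a<..<b}|lborel. u y t)"
    and primitive_diff_closed: "primitive u b t - primitive u a t = (LINT y:{a..b}|lborel. u y t)"
proof -
  have "{..b} = {..a} \<union> {a<..b}" using assms by auto
  then have "primitive u b t = primitive u a t + (LINT y:{a<..b}|lborel. u y t)"
    unfolding primitive_def using assms by (simp, subst set_integral_Un) (auto intro!: set_integrable)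
  moreover have "(LINT y:{a<..<b}|lborel. u y t) = (LINT y:{a<..b}|lborel. u y t)"
    by (rule set_integral_discrete_difference[of "{b}"]) auto
  moreover have "(LINT y:{a..b}|lborel. u y t) = (LINT y:{a<..b}|lborel. u y t)"
    by (rule set_integral_discrete_difference[of "{a}"]) auto
  ultimately show "primitive u b t - primitive u a t = (LINT y:{a<..<b}|lborel. u y t)"
    "primitive u b t - primitive u a t = (LINT y:{a..b}|lborel. u y t)" by auto
qed

lemma primitive_diff_le:
  assumes "t \<ge> 0" "a \<le> b" "\<And>y. a < y \<Longrightarrow> y < b \<Longrightarrow> u y t \<le> m"
  shows "primitive u b t - primitive u a t \<le> m * (b - a)"
proof -
  have "(LINT y:{a<..<b}|lborel. u y t) \<le> (LINT y:{a<..<b}|lborel. m)"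
    using assms by (intro set_integral_mono set_integrable) (auto simp: set_integrable_def)
  then show ?thesis using assms by (simp add: primitive_diff_open set_integral_const mult.commute)
qed

lemma primitive_diff_ge:
  assumes "t \<ge> 0" "a \<le> b" "\<And>y. a < y \<Longrightarrow> y < b \<Longrightarrow> m \<le> u y t"
  shows "m * (b - a) \<le> primitive u b t - primitive u a t"
proof -
  have "(LINT y:{a<..<b}|lborel. m) \<le> (LINT y:{a<..<b}|lborel. u y t)"
    using assms by (intro set_integral_mono set_integrable) (auto simp: set_integrable_def)
  then show ?thesis using assms by (simp add: primitive_diff_open set_integral_const mult.commute)
qed

text \<open>Covers both orders of \<open>a\<close> and \<open>b\<close>, as needed for two-sided
  difference quotients. The choice \<open>p = 0\<close>, \<open>e = K\<close> gives the Lipschitz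
  bound.\<close>

lemma primitive_diff_approx:
  assumes "t \<ge> 0" "\<And>y. \<bar>y - a\<bar> < \<bar>b - a\<bar> \<Longrightarrow> \<bar>u y t - p\<bar> \<le> e"
  shows "\<bar>primitive u b t - primitive u a t - p * (b - a)\<bar> \<le> e * \<bar>b - a\<bar>"
proof (cases "a \<le> b")
  case True
  have *: "p - e \<le> u y t \<and> u y t \<le> p + e" if "a < y" "y < b" for y
    using assms(2)[of y] that by linarith
  show ?thesis
    using primitive_diff_le[OF assms(1) True, of "p + e"] primitive_diff_ge[OF assms(1) True, of "p - e"] * True
    by (simp add: algebra_simps abs_le_iff)
next
  case False
  then have le: "b \<le> a" by simp
  have *: "p - e \<le> u y t \<and> u y t \<le> p + e" if "b < y" "y < a" for y
    using assms(2)[of y] that by linarith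
  show ?thesis
    using primitive_diff_le[OF assms(1) le, of "p + e"] primitive_diff_ge[OF assms(1) le, of "p - e"] * False
    by (simp add: algebra_simps abs_le_iff)
qed

lemma primitive_lipschitz:
  "t \<ge> 0 \<Longrightarrow> \<bar>primitive u b t - primitive u a t\<bar> \<le> K * \<bar>b - a\<bar>"
  using primitive_diff_approx[of t a b 0 K] bound by simp

lemma K_nonneg: "K \<ge> 0"
  using bound[of 0 0] by simp

lemma primitive_right_const:
  assumes "t \<ge> 0" "R + L * t \<le> a" "a \<le> b"
  shows "primitive u b t = primitive u a t"
proof -
  have "u y t = 0" if "a < y" for y using that assms by (intro support) auto
  then show ?thesis
    using primitive_diff_le[OF assms(1,3), of 0] primitive_diff_ge[OF assms(1,3), of 0] by simp
qed

lemma primitive_left_zero: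
  assumes "t \<ge> 0" "b \<le> - (R + L * t)"
  shows "primitive u b t = 0"
proof -
  have "u y t = 0" if "y < b" for y using that assms by (intro support) auto
  then have "(LINT y:{..<b}|lborel. u y t) = (LINT y:{..<b}|lborel. 0)"
    by (intro set_lebesgue_integral_cong) auto
  moreover have "(LINT y:{..b}|lborel. u y t) = (LINT y:{..<b}|lborel. u y t)"
    by (rule set_integral_discrete_difference[of "{b}"]) auto
  ultimately show ?thesis unfolding primitive_def by simp
qed

text \<open>A fundamental theorem of calculus that asks for continuity at the single point
  \<open>x\<close>.\<close>

lemma primitive_has_derivative:
  assumes "t \<ge> 0" "isCont (\<lambda>y. u y t) x"
  shows "((\<lambda>y. primitive u y t) has_real_derivative u x t) (at x)"
  unfolding has_field_derivative_iff LIM_eq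
proof (intro allI impI)
  fix e :: real assume "e > 0"
  then obtain d where d: "d > 0" "\<And>y. \<bar>y - x\<bar> < d \<Longrightarrow> \<bar>u y t - u x t\<bar> < e / 2"
    using assms(2) unfolding continuous_at_eps_delta dist_real_def by (meson half_gt_zero)
  show "\<exists>d>0. \<forall>y. y \<noteq> x \<and> norm (y - x) < d \<longrightarrow>
      norm ((primitive u y t - primitive u x t) / (y - x) - u x t) < e"
  proof (intro exI[of _ d] conjI allI impI d(1))
    fix y assume y: "y \<noteq> x \<and> norm (y - x) < d"
    have "\<bar>primitive u y t - primitive u x t - u x t * (y - x)\<bar> \<le> e / 2 * \<bar>y - x\<bar>"
      using y d(2) by (intro primitive_diff_approx[OF assms(1)] less_imp_le) auto
    also have "primitive u y t - primitive u x t - u x t * (y - x) =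
        ((primitive u y t - primitive u x t) / (y - x) - u x t) * (y - x)"
      using y by (simp add: field_simps)
    finally have "\<bar>(primitive u y t - primitive u x t) / (y - x) - u x t\<bar> \<le> e / 2"
      using y unfolding abs_mult by (simp add: mult_le_cancel_right)
    then show "norm ((primitive u y t - primitive u x t) / (y - x) - u x t) < e"
      using \<open>e > 0\<close> by simp
  qed
qed

text \<open>An upward jump makes the second difference at \<open>x\<close> at least linear in
  \<open>d\<close>, and this beats any quadratic as \<open>d\<close> tends to 0.\<close>

lemma primitive_convex_kink:
  assumes "t \<ge> 0" "((\<lambda>x. u x t) \<longlongrightarrow> um) (at_left x)" "((\<lambda>x. u x t) \<longlongrightarrow> up) (at_right x)" "um < up"
  shows "\<exists>d. M * d\<^sup>2 < primitive u (x + d) t + primitive u (x - d) t - 2 * primitive u x t"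
proof -
  \<comment> \<open>With a third of the jump, the slopes \<open>um + e\<close> and
    \<open>up - e\<close> on the two sides still differ by \<open>e\<close>.\<close>
  define e where "e = (up - um) / 3"
  have "e > 0" using assms(4) by (simp add: e_def)
  have "\<forall>\<^sub>F y in at_left x. u y t < um + e" "\<forall>\<^sub>F y in at_right x. up - e < u y t"
    using order_tendstoD[OF assms(2)] order_tendstoD[OF assms(3)] \<open>e > 0\<close> by auto
  then obtain l r where l: "l < x" "\<And>y. l < y \<Longrightarrow> y < x \<Longrightarrow> u y t < um + e"
    and r: "x < r" "\<And>y. x < y \<Longrightarrow> y < r \<Longrightarrow> up - e < u y t"
    unfolding eventually_at_left_field eventually_at_right_field by blast
  \<comment> \<open>The first two terms keep \<open>x - d\<close> and \<open>x + d\<close> where the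
    slope bounds hold; the last one gives \<open>\<bar>M\<bar> * d \<le> e / 2\<close>.\<close>
  define d where "d = min (min (x - l) (r - x)) (e / (2 * (\<bar>M\<bar> + 1)))"
  have d: "d > 0" "l \<le> x - d" "x + d \<le> r" "d \<le> e / (2 * (\<bar>M\<bar> + 1))"
    using l(1) r(1) \<open>e > 0\<close> unfolding d_def by auto
  have "(up - e) * (x + d - x) \<le> primitive u (x + d) t - primitive u x t"
    using d r(2) by (intro primitive_diff_ge assms(1) less_imp_le) auto
  moreover have "primitive u x t - primitive u (x - d) t \<le> (um + e) * (x - (x - d))"
    using d l(2) by (intro primitive_diff_le assms(1) less_imp_le) auto
  moreover have "(up - e) * (x + d - x) - (um + e) * (x - (x - d)) = e * d"
    by (simp add: e_def field_simps)
  ultimately have "e * d \<le> primitive u (x + d) t + primitive u (x - d) t - 2 * primitive u x t"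
    by linarith
  moreover have "M * d\<^sup>2 < e * d"
  proof -
    have "M * d \<le> \<bar>M\<bar> * d" using d(1) by (intro mult_right_mono) auto
    also have "\<dots> \<le> (\<bar>M\<bar> + 1) * (e / (2 * (\<bar>M\<bar> + 1)))" using d by (intro mult_mono) auto
    also have "\<dots> < e" using \<open>e > 0\<close> by (simp add: field_simps add_pos_nonneg)
    finally show ?thesis using d(1) by (simp add: power2_eq_square)
  qed
  ultimately show ?thesis by (intro exI[of _ d]) linarith
qed

end

section \<open>Time regularity of the primitive and the Hamilton-Jacobi equation\<close>

text \<open>\<open>initial_trace\<close> ties the values at time 0 to those at positive times, where
  shocks say nothing; it makes the primitive continuous down to \<open>t = 0\<close>.\<close>

locale entropy_solution = bounded_profile +
  fixes f :: "real \<Rightarrow> real"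
  assumes tangent: "f q \<le> f p + deriv f p * (q - p)"
    and initial_trace: "finite {x. \<not> continuous (at_right 0) (u x)}"
    and shock_paths: "piecewise_smooth_shocks u"
    and integral_form: "integral_form_solution f u"
    and increasing: "increasing_shocks u"
begin

lemma shock_path_family:
  obtains P :: "(real set \<times> (real \<Rightarrow> real)) set" where "finite P"
    and "\<And>I s. (I, s) \<in> P \<Longrightarrow> s piecewise_C1_differentiable_on I"
    and "\<And>x t. (x, t) \<in> shocks u \<Longrightarrow> \<exists>(I, s)\<in>P. t \<in> I \<and> x = s t"
proof -
  obtain P :: "(real set \<times> (real \<Rightarrow> real)) set" where P: "finite P"
    "\<forall>(I, s)\<in>P. is_interval I \<and> I \<subseteq> {0<..} \<and> s piecewise_C1_differentiable_on I"
    "shocks u \<subseteq> (\<Union>(I, s)\<in>P. (\<lambda>t. (s t, t)) ` I)"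
    using shock_paths unfolding piecewise_smooth_shocks_def by blast
  show thesis
  proof (rule that[OF P(1)])
    show "s piecewise_C1_differentiable_on I" if "(I, s) \<in> P" for I s using P(2) that by blast
    show "\<exists>(I, s)\<in>P. t \<in> I \<and> x = s t" if "(x, t) \<in> shocks u" for x t
      using subsetD[OF P(3) that] by fast
  qed
qed

lemma finite_shocks_at: "finite {x. (x, t) \<in> shocks u}"
proof -
  obtain P :: "(real set \<times> (real \<Rightarrow> real)) set" where P: "finite P"
    "\<And>x t. (x, t) \<in> shocks u \<Longrightarrow> \<exists>(I, s)\<in>P. t \<in> I \<and> x = s t"
    using shock_path_family by metis
  have "{x. (x, t) \<in> shocks u} \<subseteq> (\<lambda>(I, s). s t) ` P"
    using P(2) by fastforce
  then show ?thesis using P(1) finite_surj by blast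
qed

definition singular_times :: "real set" where
  "singular_times = snd ` singular_shocks u"

lemma finite_singular_times: "finite (singular_times \<inter> {..T})"
proof -
  have "finite {(x, t) \<in> singular_shocks u. t \<le> T}"
    using shock_paths unfolding piecewise_smooth_shocks_def by blast
  then have "finite (snd ` {(x, t) \<in> singular_shocks u. t \<le> T})" by (rule finite_imageI)
  moreover have "singular_times \<inter> {..T} \<subseteq> snd ` {(x, t) \<in> singular_shocks u. t \<le> T}"
    unfolding singular_times_def by force
  ultimately show ?thesis by (rule finite_subset[rotated])
qed

lemma not_shockD:
  assumes "t > 0" "(x, t) \<notin> shocks u"
  shows isCont_time: "isCont (u x) t" and isCont_space: "isCont (\<lambda>y. u y t) x"
    and isCont_joint: "isCont (\<lambda>(x, t). u x t) (x, t)"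
proof -
  show *: "isCont (\<lambda>(x, t). u x t) (x, t)"
    using assms unfolding shocks_def continuous_at_point_def by auto
  have "isCont (\<lambda>\<tau>. (x, \<tau>)) t" "isCont (\<lambda>y. (y, t)) x" by (intro continuous_intros)+
  from isCont_o2[OF this(1) *] isCont_o2[OF this(2) *]
  show "isCont (u x) t" "isCont (\<lambda>y. u y t) x" by simp_all
qed

text \<open>Dominated convergence: \<open>u y\<close> is continuous in time at \<open>t\<close> for
  all but finitely many \<open>y\<close>, and a convergent sequence of times is bounded, so all
  profiles live in one interval \<open>{-B..B}\<close>.\<close>

lemma primitive_tendsto:
  assumes X: "X \<longlonglongrightarrow> t" "\<And>n. X n \<ge> 0" and "t \<ge> 0"
  shows "(\<lambda>n. primitive u x (X n)) \<longlonglongrightarrow> primitive u x t"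
proof -
  \<comment> \<open>Finite by \<open>initial_trace\<close> when \<open>t = 0\<close> and by
    finiteness of the shocks at time \<open>t\<close> otherwise.\<close>
  define N where "N = {y. \<not> continuous (at t within {0..}) (u y)}"
  have "finite N"
  proof (cases "t = 0")
    case True
    then show ?thesis
      using initial_trace unfolding N_def by (simp add: at_within_Ici_at_right)
  next
    case False
    then have "N \<subseteq> {y. (y, t) \<in> shocks u}"
      using isCont_time[of t] \<open>t \<ge> 0\<close> unfolding N_def by (force intro: continuous_at_imp_continuous_at_within)
    then show ?thesis using finite_shocks_at finite_subset by blast
  qed
  then have "AE y in lborel. y \<notin> N"
    by (intro AE_not_in countable_imp_null_set_lborel countable_finite)
  have lim: "(\<lambda>n. u y (X n)) \<longlonglongrightarrow> u y t" if "y \<notin> N" for y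
    using that X unfolding N_def by (auto intro: continuous_within_tendsto_compose')
  have "Bseq X" using X(1) by (intro convergent_imp_Bseq convergentI)
  then obtain T where "\<And>n. norm (X n) \<le> T" unfolding Bseq_def by blast
  then have T: "\<And>n. X n \<le> T" by (simp add: abs_le_iff)
  define B where "B = R + L * T"
  have out: "u y (X n) = 0" if "B < \<bar>y\<bar>" for y n
    using that X(2)[of n] T[of n] L_nonneg mult_left_mono[of "X n" T L]
    by (intro support) (auto simp: B_def)
  show ?thesis
    unfolding primitive_def set_lebesgue_integral_def
  proof (rule integral_dominated_convergence[where w = "\<lambda>y. indicator {-B..B} y * K"])
    show "(\<lambda>y. indicator {..x} y *\<^sub>R u y t) \<in> borel_measurable lborel"
      using integrable[OF \<open>t \<ge> 0\<close>] by measurable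
    show "(\<lambda>y. indicator {..x} y *\<^sub>R u y (X n)) \<in> borel_measurable lborel" for n
      using integrable[OF X(2)[of n]] by measurable
    show "AE y in lborel. (\<lambda>n. indicator {..x} y *\<^sub>R u y (X n)) \<longlonglongrightarrow> indicator {..x} y *\<^sub>R u y t"
      using \<open>AE y in lborel. y \<notin> N\<close> by eventually_elim (intro tendsto_intros lim)
    show "AE y in lborel. norm (indicator {..x} y *\<^sub>R u y (X n)) \<le> indicator {-B..B} y * K" for n
      using out[of _ n] bound[OF X(2)[of n]] K_nonneg
      by (intro AE_I2) (auto simp: indicator_def abs_le_iff not_le)
    show "Bochner_Integration.integrable lborel (\<lambda>y. indicator {-B..B} y * K)"
      by (intro integrable_mult_left integrable_real_indicator) (auto simp: emeasure_lborel_Icc_eq)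
  qed
qed

text \<open>Continuity in time combines with a Lipschitz bound in space that is uniform in time.
  Arbitrary \<open>a\<close> and \<open>b\<close> allow its use along lines and for the doubled
  functional.\<close>

lemma continuous_on_primitive:
  fixes S :: "'a::metric_space set"
  assumes "continuous_on S a" "continuous_on S b" "\<And>z. z \<in> S \<Longrightarrow> b z \<ge> (0::real)"
  shows "continuous_on S (\<lambda>z. primitive u (a z) (b z))"
  unfolding continuous_on_sequentially
proof (intro allI ballI impI)
  fix X z assume "z \<in> S" and X: "(\<forall>n. X n \<in> S) \<and> X \<longlonglongrightarrow> z"
  then have lim: "(\<lambda>n. a (X n)) \<longlonglongrightarrow> a z" "(\<lambda>n. b (X n)) \<longlonglongrightarrow> b z"
    using assms(1,2) unfolding continuous_on_sequentially by (auto simp: o_def)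
  have nonneg: "b (X n) \<ge> 0" "b z \<ge> 0" for n using X \<open>z \<in> S\<close> assms(3) by auto
  have "(\<lambda>n. primitive u (a (X n)) (b (X n)) - primitive u (a z) (b (X n))) \<longlonglongrightarrow> 0"
  proof (rule Lim_null_comparison)
    show "\<forall>\<^sub>F n in sequentially. norm (primitive u (a (X n)) (b (X n)) - primitive u (a z) (b (X n)))
        \<le> K * \<bar>a (X n) - a z\<bar>"
      using primitive_lipschitz nonneg by simp
    show "(\<lambda>n. K * \<bar>a (X n) - a z\<bar>) \<longlonglongrightarrow> 0"
      using tendsto_mult_right_zero[OF tendsto_rabs_zero[OF LIM_zero[OF lim(1)]]] .
  qed
  from tendsto_add[OF this primitive_tendsto[OF lim(2) nonneg, of "a z"]]
  show "((\<lambda>z. primitive u (a z) (b z)) \<circ> X) \<longlonglongrightarrow> primitive u (a z) (b z)"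
    by (simp add: o_def)
qed

text \<open>The Hamilton-Jacobi equation off the shocks: the integral form is applied on
  \<open>{a..x}\<close> with \<open>a\<close> so far left that \<open>u\<close> vanishes around
  \<open>(a, t)\<close>.\<close>

lemma primitive_has_time_derivative:
  assumes "t > 0" "t \<notin> singular_times" "(x, t) \<notin> shocks u"
  shows "(primitive u x has_real_derivative f 0 - f (u x t)) (at t)"
proof -
  \<comment> \<open>Bounds the support throughout a time window around \<open>t\<close>, since a
    derivative in time needs the left end to be quiet at nearby times too.\<close>
  define B where "B = R + L * (t + 1)"
  define a where "a = min x (- B) - 1"
  have far: "u y \<tau> = 0" if "0 \<le> \<tau>" "\<tau> < t + 1" "B < \<bar>y\<bar>" for y \<tau>
    using that L_nonneg mult_left_mono[of \<tau> "t + 1" L] by (intro support) (auto simp: B_def)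
  have "continuous_at_point u a t"
  proof -
    have "open {(y, \<tau>). 0 < \<tau> \<and> \<tau> < t + 1 \<and> B < \<bar>y\<bar>}"
      unfolding case_prod_unfold by (intro open_Collect_conj open_Collect_less continuous_intros)
    moreover have "(a, t) \<in> {(y, \<tau>). 0 < \<tau> \<and> \<tau> < t + 1 \<and> B < \<bar>y\<bar>}"
      using \<open>t > 0\<close> unfolding a_def by auto
    ultimately have "\<forall>\<^sub>F z in nhds (a, t). (case z of (y, \<tau>) \<Rightarrow> u y \<tau>) = 0"
      using far by (auto intro!: eventually_nhds_in_open[THEN eventually_mono])
    from isCont_cong[OF this] show ?thesis unfolding continuous_at_point_def by simp
  qed
  moreover have "continuous_at_point u x t"
    using assms unfolding shocks_def by auto
  moreover have "singular_shocks u \<inter> {a..x} \<times> {t} = {}"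
    using assms(2) unfolding singular_times_def by force
  moreover have "a < x" unfolding a_def by simp
  moreover have "u a t = 0" using far \<open>t > 0\<close> unfolding a_def by auto
  ultimately have "((\<lambda>\<tau>. LINT y:{a..x}|lborel. u y \<tau>) has_real_derivative f 0 - f (u x t)) (at t)"
    using integral_form \<open>t > 0\<close> unfolding integral_form_solution_def by metis
  moreover have "(LINT y:{a..x}|lborel. u y \<tau>) = primitive u x \<tau>" if "\<tau> \<in> {0<..<t+1}" for \<tau>
  proof -
    have "R + L * \<tau> \<le> B" using that L_nonneg by (auto simp: B_def intro!: mult_left_mono)
    then have "primitive u a \<tau> = 0" using that by (intro primitive_left_zero) (auto simp: a_def)
    then show ?thesis using primitive_diff_closed[of \<tau> a x] that \<open>a < x\<close> by auto
  qed
  ultimately show ?thesis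
    using \<open>t > 0\<close> by (elim has_field_derivative_transform_within_open[where S = "{0<..<t+1}"]) auto
qed

text \<open>A chain rule obtained without total differentiability of the primitive: the space
  increment \<open>E\<close> is estimated by joint continuity of \<open>u\<close> at
  \<open>(x, t)\<close>.\<close>

lemma primitive_has_derivative_along:
  assumes "t > 0" "t \<notin> singular_times" "(x, t) \<notin> shocks u"
  shows "((\<lambda>\<tau>. primitive u (x + w * (\<tau> - t)) \<tau>) has_real_derivative f 0 - f (u x t) + w * u x t) (at t)"
proof -
  define E where "E = (\<lambda>\<tau>. primitive u (x + w * (\<tau> - t)) \<tau> - primitive u x \<tau>)"
  have "(E has_real_derivative w * u x t) (at t)"
    unfolding has_field_derivative_iff LIM_eq
  proof (intro allI impI)
    fix e :: real assume "e > 0"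
    define e' where "e' = e / (\<bar>w\<bar> + 1)"
    have e': "e' > 0" "e' * \<bar>w\<bar> < e" using \<open>e > 0\<close> unfolding e'_def by (auto simp: field_simps)
    obtain d where d: "d > 0" "\<And>z. dist z (x, t) < d \<Longrightarrow> \<bar>(case z of (x, t) \<Rightarrow> u x t) - u x t\<bar> < e'"
      using isCont_joint[OF assms(1,3)] e'(1) unfolding continuous_at_eps_delta dist_real_def
      by (metis case_prod_conv)
    \<comment> \<open>The first term keeps \<open>\<tau>\<close> nonnegative; the second keeps the
      whole integration segment at time \<open>\<tau>\<close> within distance \<open>d\<close> of
      \<open>(x, t)\<close>.\<close>
    define r where "r = min t (d / (\<bar>w\<bar> + 1))"
    have "r > 0" using d(1) \<open>t > 0\<close> unfolding r_def by simp
    show "\<exists>r>0. \<forall>\<tau>. \<tau> \<noteq> t \<and> norm (\<tau> - t) < r \<longrightarrow> norm ((E \<tau> - E t) / (\<tau> - t) - w * u x t) < e"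
    proof (intro exI[of _ r] conjI allI impI \<open>r > 0\<close>)
      fix \<tau> assume \<tau>: "\<tau> \<noteq> t \<and> norm (\<tau> - t) < r"
      then have "\<tau> \<ge> 0" unfolding r_def by auto
      have small: "\<bar>w * (\<tau> - t)\<bar> + \<bar>\<tau> - t\<bar> < d"
      proof -
        have "(\<bar>w\<bar> + 1) * \<bar>\<tau> - t\<bar> < (\<bar>w\<bar> + 1) * (d / (\<bar>w\<bar> + 1))"
          using \<tau> unfolding r_def by (intro mult_strict_left_mono) auto
        also have "\<dots> = d" by simp
        finally show ?thesis unfolding abs_mult by (simp add: distrib_right)
      qed
      have "\<bar>primitive u (x + w * (\<tau> - t)) \<tau> - primitive u x \<tau> - u x t * (x + w * (\<tau> - t) - x)\<bar>
          \<le> e' * \<bar>x + w * (\<tau> - t) - x\<bar>"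
      proof (rule primitive_diff_approx[OF \<open>\<tau> \<ge> 0\<close>])
        fix y assume "\<bar>y - x\<bar> < \<bar>x + w * (\<tau> - t) - x\<bar>"
        then have "\<bar>y - x\<bar> + \<bar>\<tau> - t\<bar> < d" using small by simp
        moreover have "dist (y, \<tau>) (x, t) \<le> \<bar>y - x\<bar> + \<bar>\<tau> - t\<bar>"
          unfolding dist_Pair_Pair dist_real_def using sqrt_sum_squares_le_sum_abs by auto
        ultimately show "\<bar>u y \<tau> - u x t\<bar> \<le> e'" using d(2)[of "(y, \<tau>)"] by simp
      qed
      also have "primitive u (x + w * (\<tau> - t)) \<tau> - primitive u x \<tau> - u x t * (x + w * (\<tau> - t) - x) =
          ((E \<tau> - E t) / (\<tau> - t) - w * u x t) * (\<tau> - t)"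
        using \<tau> unfolding E_def by (simp add: field_simps)
      also have "e' * \<bar>x + w * (\<tau> - t) - x\<bar> = (e' * \<bar>w\<bar>) * \<bar>\<tau> - t\<bar>" by (simp add: abs_mult)
      finally have "\<bar>(E \<tau> - E t) / (\<tau> - t) - w * u x t\<bar> \<le> e' * \<bar>w\<bar>"
        using \<tau> unfolding abs_mult by (simp add: mult_le_cancel_right)
      then show "norm ((E \<tau> - E t) / (\<tau> - t) - w * u x t) < e" using e'(2) by simp
    qed
  qed
  from DERIV_add[OF primitive_has_time_derivative[OF assms] this] show ?thesis
    unfolding E_def by simp
qed

section \<open>The Hopf-Lax lower bound along straight lines\<close>

text \<open>The line meets the path \<open>s\<close> exactly when \<open>s t - w * t = c\<close>. On
  the smooth parts of a path, uncountable fibres of this function occur for a negligible set of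
  \<open>c\<close> only; the break points of the paths are finitely many.\<close>

lemma countable_shocks_on_generic_line:
  obtains N where "negligible N" "\<And>c. c \<notin> N \<Longrightarrow> countable {t. (c + w * t, t) \<in> shocks u}"
proof -
  obtain P :: "(real set \<times> (real \<Rightarrow> real)) set" where P: "finite P"
    "\<And>I s. (I, s) \<in> P \<Longrightarrow> s piecewise_C1_differentiable_on I"
    "\<And>x t. (x, t) \<in> shocks u \<Longrightarrow> \<exists>(I, s)\<in>P. t \<in> I \<and> x = s t"
    using shock_path_family by metis
  have "\<exists>S. finite S \<and> s C1_differentiable_on (I - S)" if "(I, s) \<in> P" for I s
    using P(2)[OF that] unfolding piecewise_C1_differentiable_on_def by blast
  then obtain S where S: "\<And>I s. (I, s) \<in> P \<Longrightarrow> finite (S I s)"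
    "\<And>I s. (I, s) \<in> P \<Longrightarrow> s C1_differentiable_on (I - S I s)"
    by metis
  define Z where "Z = (\<lambda>c (I, s). {t \<in> I - S I s. s t - w * t = c})"
  define N where "N = (\<Union>p\<in>P. {c. uncountable (Z c p)})"
  show thesis
  proof (rule that[of N])
    have "negligible {c. uncountable (Z c p)}" if "p \<in> P" for p
    proof -
      obtain I s where p: "p = (I, s)" by (cases p)
      have "(\<lambda>t. s t - w * t) differentiable (at t)" if "t \<in> I - S I s" for t
        using S(2)[of I s] that \<open>p \<in> P\<close> unfolding p C1_differentiable_on_eq
        by (intro derivative_intros) auto
      then have "negligible {c. uncountable {t \<in> I - S I s. s t - w * t = c}}"
        by (rule negligible_uncountable_fibres)
      then show ?thesis by (simp add: p Z_def)
    qed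
    then show "negligible N" unfolding N_def using P(1) by (intro negligible_Union) auto
  next
    fix c assume "c \<notin> N"
    then have Z: "countable (Z c p)" if "p \<in> P" for p using that unfolding N_def by auto
    have "{t. (c + w * t, t) \<in> shocks u} \<subseteq> (\<Union>p\<in>P. Z c p \<union> (case p of (I, s) \<Rightarrow> S I s))"
    proof
      fix t assume "t \<in> {t. (c + w * t, t) \<in> shocks u}"
      then obtain I s where "(I, s) \<in> P" "t \<in> I" "c + w * t = s t" using P(3) by blast
      then show "t \<in> (\<Union>p\<in>P. Z c p \<union> (case p of (I, s) \<Rightarrow> S I s))"
        unfolding Z_def by (intro UN_I[of "(I, s)"]) auto
    qed
    moreover have "countable (\<Union>p\<in>P. Z c p \<union> (case p of (I, s) \<Rightarrow> S I s))"
      using P(1) Z S(1) by (intro countable_UN countable_Un) (auto intro: countable_finite)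
    ultimately show "countable {t. (c + w * t, t) \<in> shocks u}" by (rule countable_subset)
  qed
qed

text \<open>
  The line itself may run along a shock, so the bound is proved on generic translates of it, which
  meet the shock paths only countably often, and passes to the limit.
\<close>

lemma primitive_hopf_lax:
  assumes "0 \<le> s" "s \<le> t"
  shows "(f 0 - f p + deriv f p * p) * (t - s)
    \<le> primitive u y t - primitive u (y - deriv f p * (t - s)) s"
proof -
  \<comment> \<open>By the tangent bound, \<open>m\<close> is the least value of
    \<open>f 0 - f q + w * q\<close> over all \<open>q\<close>, attained at
    \<open>q = p\<close>.\<close>
  define w m where "w = deriv f p" and "m = f 0 - f p + w * p"
  define k where "k = (\<lambda>c \<tau>. primitive u (c + w * \<tau>) \<tau>)"
  obtain N where N: "negligible N" "\<And>c. c \<notin> N \<Longrightarrow> countable {t. (c + w * t, t) \<in> shocks u}"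
    using countable_shocks_on_generic_line by metis
  have generic: "m * (t - s) \<le> k c t - k c s" if "c \<notin> N" for c
  proof (rule increment_ge_off_countable[OF \<open>s \<le> t\<close>])
    show "continuous_on {s..t} (k c)"
      unfolding k_def using assms(1) by (intro continuous_on_primitive continuous_intros) auto
    show "countable ({t. (c + w * t, t) \<in> shocks u} \<union> (singular_times \<inter> {..t}))"
      using N(2)[OF that] finite_singular_times by (simp add: countable_finite)
    fix \<tau> assume \<tau>: "s < \<tau>" "\<tau> \<le> t" "\<tau> \<notin> {t. (c + w * t, t) \<in> shocks u} \<union> (singular_times \<inter> {..t})"
    define q where "q = u (c + w * \<tau>) \<tau>"
    have "((\<lambda>\<tau>'. primitive u (c + w * \<tau> + w * (\<tau>' - \<tau>)) \<tau>') has_real_derivative f 0 - f q + w * q) (at \<tau>)"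
      unfolding q_def using \<tau> assms(1) by (intro primitive_has_derivative_along) auto
    then have "(k c has_real_derivative f 0 - f q + w * q) (at \<tau>)"
      unfolding k_def by (simp add: algebra_simps)
    moreover have "m \<le> f 0 - f q + w * q"
      using tangent[of q p] by (simp add: m_def w_def algebra_simps)
    ultimately show "\<exists>d\<ge>m. (k c has_real_derivative d) (at \<tau>)" by blast
  qed
  have "m * (t - s) \<le> k c t - k c s" for c
  proof (rule field_le_epsilon)
    fix e :: real assume "e > 0"
    \<comment> \<open>By the Lipschitz bound in \<open>c\<close>, passing to a generic
      \<open>c'\<close> costs at most \<open>e / 2\<close> at each of the two times;
      \<open>K + 1\<close> avoids dividing by 0.\<close>
    define d where "d = e / 2 / (K + 1)"
    have "d > 0" using \<open>e > 0\<close> K_nonneg by (simp add: d_def)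
    then have "\<not> ball c d \<subseteq> N"
      using N(1) open_not_negligible[of "ball c d"] negligible_subset by auto
    then obtain c' where "c' \<in> ball c d" "c' \<notin> N" by blast
    then have c': "c' \<notin> N" "\<bar>c - c'\<bar> < d" by (auto simp: dist_real_def)
    have close: "\<bar>k c \<tau> - k c' \<tau>\<bar> \<le> e / 2" if "\<tau> \<ge> 0" for \<tau>
    proof -
      have "\<bar>k c \<tau> - k c' \<tau>\<bar> \<le> K * \<bar>c - c'\<bar>"
        using primitive_lipschitz[OF that, of "c + w * \<tau>" "c' + w * \<tau>"] by (simp add: k_def)
      also have "\<dots> \<le> (K + 1) * d" using c'(2) K_nonneg by (intro mult_mono) auto
      also have "\<dots> = e / 2"
        using K_nonneg by (simp only: d_def) (simp del: divide_divide_eq_left)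
      finally show ?thesis .
    qed
    show "m * (t - s) \<le> k c t - k c s + e"
      using generic[OF c'(1)] close[of t] close[of s] assms by linarith
  qed
  from this[of "y - w * t"] show ?thesis by (simp add: k_def m_def w_def algebra_simps)
qed

end

section \<open>Comparison by doubling the space variable\<close>

lemma SUP_compact_attained:
  fixes g :: "'a::metric_space \<Rightarrow> real"
  assumes "compact S" "S \<noteq> {}" "continuous_on S g"
  obtains z where "z \<in> S" "g z = (SUP z\<in>S. g z)" "\<And>z'. z' \<in> S \<Longrightarrow> g z' \<le> (SUP z\<in>S. g z)"
proof -
  obtain z where z: "z \<in> S" "\<And>z'. z' \<in> S \<Longrightarrow> g z' \<le> g z"
    using continuous_attains_sup[OF assms] by blast
  then have "(SUP z\<in>S. g z) = g z" by (intro cSup_eq_maximum) auto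
  then show thesis using z that by metis
qed

text \<open>A maximiser at one time is a competitor at the other, and uniform continuity on the
  compact product bounds the difference of its values.\<close>

lemma continuous_on_SUP_compact:
  fixes g :: "'a::metric_space \<Rightarrow> real \<Rightarrow> real"
  assumes "compact S" "S \<noteq> {}" and cont: "continuous_on (S \<times> {a..b}) (\<lambda>(z, t). g z t)"
  shows "continuous_on {a..b} (\<lambda>t. SUP z\<in>S. g z t)"
  unfolding continuous_on_iff
proof (intro ballI allI impI)
  fix t and e :: real assume t: "t \<in> {a..b}" and "e > 0"
  have slice: "continuous_on S (\<lambda>z. g z r)" if "r \<in> {a..b}" for r
    using continuous_on_compose2[OF cont, of S "\<lambda>z. (z, r)"] that by (force intro: continuous_intros)
  have "uniformly_continuous_on (S \<times> {a..b}) (\<lambda>(z, t). g z t)"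
    using cont \<open>compact S\<close> by (intro compact_uniformly_continuous compact_Times) auto
  then obtain d where d: "d > 0" "\<And>p q. p \<in> S \<times> {a..b} \<Longrightarrow> q \<in> S \<times> {a..b} \<Longrightarrow> dist q p < d \<Longrightarrow>
      dist ((\<lambda>(z, t). g z t) q) ((\<lambda>(z, t). g z t) p) < e"
    using \<open>e > 0\<close> unfolding uniformly_continuous_on_def by meson
  have less: "(SUP z\<in>S. g z r) < (SUP z\<in>S. g z r') + e"
    if r: "r \<in> {a..b}" "r' \<in> {a..b}" "\<bar>r - r'\<bar> < d" for r r'
  proof -
    obtain z where z: "z \<in> S" "g z r = (SUP z\<in>S. g z r)"
      using SUP_compact_attained[OF assms(1,2) slice[OF r(1)]] by metis
    have "g z r' \<le> (SUP z\<in>S. g z r')"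
      using SUP_compact_attained[OF assms(1,2) slice[OF r(2)]] z(1) by metis
    moreover have "\<bar>g z r - g z r'\<bar> < e"
      using d(2)[of "(z, r')" "(z, r)"] z(1) r by (simp add: dist_Pair_Pair dist_real_def)
    ultimately show ?thesis using z(2) by linarith
  qed
  show "\<exists>d>0. \<forall>r\<in>{a..b}. dist r t < d \<longrightarrow> dist (SUP z\<in>S. g z r) (SUP z\<in>S. g z t) < e"
  proof (intro exI[of _ d] conjI ballI impI d(1))
    fix r assume r: "r \<in> {a..b}" "dist r t < d"
    then show "dist (SUP z\<in>S. g z r) (SUP z\<in>S. g z t) < e"
      using less[OF r(1) t] less[OF t r(1)] by (simp add: dist_real_def abs_less_iff)
  qed
qed

text \<open>The primitive is constant on either side of the support, so a supremum over the plane
  can be taken over a compact square.\<close>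

lemma (in bounded_profile) primitive_clamp:
  assumes "t \<ge> 0" "R + L * t \<le> B" "B \<ge> 0"
  shows "primitive u (max (-B) (min B x)) t = primitive u x t"
proof -
  consider "x < - B" | "x \<in> {-B..B}" | "B < x" by fastforce
  then show ?thesis
  proof cases
    case 1
    then have "primitive u x t = 0" "primitive u (-B) t = 0"
      using assms by (auto intro!: primitive_left_zero)
    then show ?thesis using 1 \<open>B \<ge> 0\<close> by simp
  next
    case 3
    then have "primitive u x t = primitive u B t"
      using assms by (intro primitive_right_const) auto
    then show ?thesis using 3 \<open>B \<ge> 0\<close> by simp
  qed simp
qed

text \<open>Doubling lets \<open>a\<close> vary with \<open>b\<close> fixed, so a kink of the
  primitive of \<open>v\<close> cannot cancel that of \<open>u\<close>. The primitive of
  \<open>v\<close> is used through its Hopf-Lax bound and needs no derivative at \<open>b\<close>,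
  which may lie on a shock.\<close>

lemma doubled_comparison:
  assumes "entropy_solution u K R L f" "entropy_solution v K R L f"
    and init: "\<And>x. u x 0 = v x 0"
    and "T \<ge> 0" "M > 0" "lam > 0"
  shows "primitive u x T - primitive v x T \<le> K\<^sup>2 / (4 * M) + lam * T"
proof -
  interpret u: entropy_solution u K R L f by fact
  interpret v: entropy_solution v K R L f by fact
  define \<Phi> where "\<Phi> = (\<lambda>(x, y) t. primitive u x t - primitive v y t - M * (x - y)\<^sup>2 - lam * t)"
  define B where "B = \<bar>R\<bar> + L * T"
  define S where "S = {-B..B} \<times> {-B..B}"
  define \<Psi> where "\<Psi> = (\<lambda>t. SUP z\<in>S. \<Phi> z t)"
  have "B \<ge> 0" using u.L_nonneg \<open>T \<ge> 0\<close> by (simp add: B_def)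
  then have S: "compact S" "S \<noteq> {}" unfolding S_def by (auto intro: compact_Times)
  have cont: "continuous_on (S \<times> {0..T}) (\<lambda>(z, t). \<Phi> z t)"
    unfolding \<Phi>_def case_prod_unfold
    by (intro continuous_intros u.continuous_on_primitive v.continuous_on_primitive) auto
  have slice: "continuous_on S (\<lambda>z. \<Phi> z t)" if "t \<in> {0..T}" for t
    using continuous_on_compose2[OF cont, of S "\<lambda>z. (z, t)"] that by (force intro: continuous_intros)
  \<comment> \<open>Clamping both points to the square keeps the primitives and does not increase
    the penalty, because it contracts distances.\<close>
  have le_sup: "\<Phi> (a, b) t \<le> \<Psi> t" if t: "0 \<le> t" "t \<le> T" for a b t
  proof -
    define cl where "cl = (\<lambda>x. max (-B) (min B x))"
    have "L * t \<le> L * T" using t u.L_nonneg by (intro mult_left_mono)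
    then have "R + L * t \<le> B" unfolding B_def by linarith
    then have "primitive u (cl a) t = primitive u a t" "primitive v (cl b) t = primitive v b t"
      unfolding cl_def using t \<open>B \<ge> 0\<close> by (auto intro: u.primitive_clamp v.primitive_clamp)
    moreover have "M * (cl a - cl b)\<^sup>2 \<le> M * (a - b)\<^sup>2"
    proof (rule mult_left_mono)
      have "\<bar>cl a - cl b\<bar> \<le> \<bar>a - b\<bar>" unfolding cl_def by linarith
      then show "(cl a - cl b)\<^sup>2 \<le> (a - b)\<^sup>2" by (simp only: abs_le_square_iff)
    qed (use \<open>M > 0\<close> in simp)
    ultimately have "\<Phi> (a, b) t \<le> \<Phi> (cl a, cl b) t" unfolding \<Phi>_def by simp
    moreover have "(cl a, cl b) \<in> S" using \<open>B \<ge> 0\<close> unfolding S_def cl_def by simp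
    then have "\<Phi> (cl a, cl b) t \<le> \<Psi> t"
      unfolding \<Psi>_def using SUP_compact_attained[OF S slice[of t]] t by (metis atLeastAtMost_iff)
    ultimately show ?thesis by linarith
  qed
  have attained: "\<exists>a b. \<Phi> (a, b) t = \<Psi> t" if "0 \<le> t" "t \<le> T" for t
    unfolding \<Psi>_def using SUP_compact_attained[OF S slice[of t]] that by (metis atLeastAtMost_iff surj_pair)
  have "\<Psi> T \<le> \<Psi> 0"
  proof (rule nonincreasing_off_countable[OF \<open>T \<ge> 0\<close>])
    show "continuous_on {0..T} \<Psi>"
      unfolding \<Psi>_def by (rule continuous_on_SUP_compact[OF S cont])
    \<comment> \<open>Only singular times of \<open>u\<close> are exceptional here; the Hopf-Lax
      bound for \<open>v\<close> holds across those of \<open>v\<close>.\<close>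
    show "countable (u.singular_times \<inter> {..T})"
      by (rule countable_finite[OF u.finite_singular_times])
    fix t assume t: "0 < t" "t \<le> T" "t \<notin> u.singular_times \<inter> {..T}"
    obtain a b where ab: "\<Phi> (a, b) t = \<Psi> t" using attained[of t] t by auto
    have "(a, t) \<notin> shocks u"
    proof
      assume "(a, t) \<in> shocks u"
      then have "(a, t) \<in> regular_shocks u"
        using t unfolding u.singular_times_def singular_shocks_def by force
      then obtain um up where "((\<lambda>x. u x t) \<longlongrightarrow> um) (at_left a)"
        "((\<lambda>x. u x t) \<longlongrightarrow> up) (at_right a)" "um < up"
        using u.increasing unfolding increasing_shocks_def by blast
      from u.primitive_convex_kink[OF _ this, of "2 * M"] t obtain d where
        d: "2 * M * d\<^sup>2 < primitive u (a + d) t + primitive u (a - d) t - 2 * primitive u a t" by auto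
      \<comment> \<open>At a maximum the second difference in the first variable is nonpositive,
        while the penalty accounts for exactly \<open>2 * M * d\<^sup>2\<close>.\<close>
      have "\<Phi> (a + d, b) t + \<Phi> (a - d, b) t \<le> 2 * \<Phi> (a, b) t"
        using le_sup[of t "a + d" b] le_sup[of t "a - d" b] t ab by simp
      moreover have "M * (a + d - b)\<^sup>2 + M * (a - d - b)\<^sup>2 = 2 * (M * (a - b)\<^sup>2) + 2 * M * d\<^sup>2"
        by (simp add: power2_eq_square algebra_simps)
      ultimately show False using d unfolding \<Phi>_def by simp
    qed
    \<comment> \<open>\<open>w\<close> is the characteristic speed of \<open>u\<close> at
      \<open>(a, t)\<close>, and \<open>D\<close> is both the derivative of \<open>k\<close> and the
      Hopf-Lax rate for \<open>v\<close> with this \<open>p\<close>.\<close>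
    define p w D where "p = u a t" and "w = deriv f p" and "D = f 0 - f p + w * p"
    define k where "k = (\<lambda>\<tau>. primitive u (a + w * (\<tau> - t)) \<tau>)"
    have "(k has_real_derivative D) (at t)"
      unfolding k_def D_def p_def using t \<open>(a, t) \<notin> shocks u\<close>
      by (intro u.primitive_has_derivative_along) auto
    \<comment> \<open>The slack \<open>lam\<close> turns the first-order equality into a strict
      inequality for small steps back.\<close>
    then have "((\<lambda>\<tau>. k \<tau> - (D + lam) * \<tau>) has_real_derivative - lam) (at t)"
      by (auto intro!: derivative_eq_intros)
    from DERIV_neg_dec_left[OF this] \<open>lam > 0\<close> obtain r where
      r: "r > 0" "\<And>h. 0 < h \<Longrightarrow> h < r \<Longrightarrow> k t - (D + lam) * t < k (t - h) - (D + lam) * (t - h)"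
      by auto
    define h where "h = min (r / 2) t"
    have h: "0 < h" "h < r" "h \<le> t" using r(1) t unfolding h_def by auto
    have "D * h \<le> primitive v b t - primitive v (b - w * h) (t - h)"
      using v.primitive_hopf_lax[of "t - h" t p b] h by (simp add: D_def w_def)
    moreover have "primitive u a t - D * h - lam * h < primitive u (a - w * h) (t - h)"
      using r(2)[OF h(1,2)] unfolding k_def by (simp add: algebra_simps)
    \<comment> \<open>Both points shift by \<open>w * h\<close>, so the penalty is unchanged, and
      the \<open>lam\<close> terms cancel.\<close>
    ultimately have "\<Phi> (a, b) t \<le> \<Phi> (a - w * h, b - w * h) (t - h)"
      unfolding \<Phi>_def by (simp add: algebra_simps)
    also have "\<dots> \<le> \<Psi> (t - h)" using h t by (intro le_sup) auto
    finally show "\<exists>s\<ge>0. s < t \<and> \<Psi> t \<le> \<Psi> s" using h ab by (intro exI[of _ "t - h"]) auto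
  qed
  moreover have "\<Psi> 0 \<le> K\<^sup>2 / (4 * M)"
  proof -
    obtain a b where ab: "\<Phi> (a, b) 0 = \<Psi> 0" using attained[of 0] \<open>T \<ge> 0\<close> by auto
    have "primitive u a 0 = primitive v a 0" unfolding primitive_def by (simp add: init)
    then have "\<Phi> (a, b) 0 \<le> K * \<bar>a - b\<bar> - M * \<bar>a - b\<bar>\<^sup>2"
      using v.primitive_lipschitz[of 0 a b] unfolding \<Phi>_def by simp
    also have "\<dots> \<le> K\<^sup>2 / (4 * M)"
    proof -
      \<comment> \<open>Completing the square maximises \<open>K * r - M * r\<^sup>2\<close> over
        the distance \<open>r\<close>.\<close>
      have "0 \<le> (K - 2 * M * \<bar>a - b\<bar>)\<^sup>2" by simp
      then show ?thesis using \<open>M > 0\<close> by (simp add: field_simps power2_eq_square)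
    qed
    finally show ?thesis using ab by simp
  qed
  moreover have "primitive u x T - primitive v x T - lam * T \<le> \<Psi> T"
    using le_sup[of T x x] \<open>T \<ge> 0\<close> unfolding \<Phi>_def by simp
  ultimately show ?thesis by linarith
qed

text \<open>The limit of the doubled estimate as \<open>M\<close> grows and \<open>lam\<close> tends
  to 0.\<close>

lemma primitive_comparison:
  assumes "entropy_solution u K R L f" "entropy_solution v K R L f"
    and "\<And>x. u x 0 = v x 0" and "T \<ge> 0"
  shows "primitive u x T \<le> primitive v x T"
proof (rule field_le_epsilon)
  fix e :: real assume "e > 0"
  \<comment> \<open>Chosen so that each error term is at most \<open>e / 2\<close>; the added 1
    keeps \<open>M\<close> positive when \<open>K = 0\<close>.\<close>
  define M lam where "M = (K\<^sup>2 + 1) / (2 * e)" and "lam = e / 2 / (T + 1)"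
  have pos: "M > 0" "lam > 0"
    using \<open>e > 0\<close> \<open>T \<ge> 0\<close> unfolding M_def lam_def by (auto intro!: divide_pos_pos add_nonneg_pos)
  have "K\<^sup>2 / (4 * M) \<le> (K\<^sup>2 + 1) / (4 * M)" using pos by (intro divide_right_mono) auto
  also have "\<dots> = e / 2"
  proof -
    have "K\<^sup>2 + 1 \<noteq> 0" using zero_le_power2[of K] by linarith
    then show ?thesis using \<open>e > 0\<close> unfolding M_def by (simp add: field_simps)
  qed
  finally have "K\<^sup>2 / (4 * M) \<le> e / 2" .
  moreover have "lam * T \<le> lam * (T + 1)" using pos by simp
  moreover have "lam * (T + 1) = e / 2" using \<open>T \<ge> 0\<close> by (simp only: lam_def, simp del: divide_divide_eq_left)
  ultimately show "primitive u x T \<le> primitive v x T + e"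
    using doubled_comparison[OF assms pos, of x] by linarith
qed

section \<open>Characteristics and the initial trace for the class \<open>Upsilon\<close>\<close>

text \<open>Since \<open>char_map\<close> preserves the second coordinate, a point of the graph can
  be traced back to the foot of its characteristic.\<close>

lemma Upsilon_characteristic:
  assumes "u \<in> Upsilon f h" "t \<ge> 0"
  shows "(x - deriv f (u x t) * t, u x t) \<in> initial_curve h"
proof -
  have "(x, t, u x t) \<in> char_surface f h"
    using assms unfolding Upsilon_def graph_of_def by blast
  then show ?thesis unfolding char_surface_def char_curve_def char_map_def by auto
qed

text \<open>The foot of the characteristic through \<open>(x, t)\<close> lies within
  \<open>L * t\<close> of \<open>x\<close>, where \<open>h\<close> is close to \<open>h x\<close>; a
  closed ball serves as the convex set in \<open>initial_curve_near\<close>.\<close>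

lemma Upsilon_initial_trace:
  assumes "u \<in> Upsilon f h" "piecewise_C1 h" "isCont h x"
    and L: "\<And>t. t \<ge> 0 \<Longrightarrow> \<bar>deriv f (u x t)\<bar> \<le> L"
  shows "continuous (at_right 0) (u x)"
  unfolding continuous_within
proof (rule tendstoI)
  fix e :: real assume "e > 0"
  have u0: "u x 0 = h x" using assms(1) unfolding Upsilon_def by blast
  obtain d where d: "d > 0" "\<And>z. \<bar>z - x\<bar> < d \<Longrightarrow> \<bar>h z - h x\<bar> < e / 2"
    using assms(3) \<open>e > 0\<close> unfolding continuous_at_eps_delta dist_real_def by (meson half_gt_zero)
  have "L \<ge> 0" using L[of 0] by simp
  have "dist (u x t) (u x 0) < e" if t: "0 < t" "t < d / (L + 1)" for t
  proof -
    have "\<bar>deriv f (u x t) * t\<bar> \<le> (L + 1) * t"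
      unfolding abs_mult using L[of t] t \<open>L \<ge> 0\<close> by (intro mult_mono) auto
    also have "\<dots> < d" using t \<open>L \<ge> 0\<close> by (simp add: field_simps)
    finally have "x - deriv f (u x t) * t \<in> ball x d" by (simp add: dist_real_def)
    moreover have "h ` ball x d \<subseteq> cball (h x) (e / 2)"
    proof (rule image_subsetI)
      fix z assume "z \<in> ball x d"
      then have "\<bar>h z - h x\<bar> < e / 2" by (intro d(2)) (simp add: dist_real_def abs_minus_commute)
      then show "h z \<in> cball (h x) (e / 2)" by (simp add: dist_real_def abs_minus_commute)
    qed
    ultimately have "u x t \<in> cball (h x) (e / 2)"
      by (rule initial_curve_near[OF assms(2) Upsilon_characteristic[OF assms(1)] open_ball _ closed_cball convex_cball, rotated])
         (use t in simp)
    then show ?thesis using u0 \<open>e > 0\<close> by (simp add: dist_commute)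
  qed
  then show "\<forall>\<^sub>F t in at_right 0. dist (u x t) (u x 0) < e"
    using d(1) \<open>L \<ge> 0\<close> unfolding eventually_at_right_field
    by (intro exI[of _ "d / (L + 1)"]) auto
qed

text \<open>The constants depend on \<open>f\<close> and \<open>h\<close> alone, hence the
  quantifier order: they come before \<open>u\<close>.\<close>

lemma Upsilon_entropy_solutions:
  assumes "C2 f" "strictly_concave f" "piecewise_C1 h" "compactly_supported h"
  shows "\<exists>K R L. \<forall>u \<in> Upsilon f h. piecewise_smooth_shocks u \<longrightarrow> integral_form_solution f u \<longrightarrow>
    increasing_shocks u \<longrightarrow> entropy_solution u K R L f"
proof -
  obtain K R where KR: "\<And>x y. (x, y) \<in> initial_curve h \<Longrightarrow> \<bar>y\<bar> \<le> K"
    "\<And>x y. (x, y) \<in> initial_curve h \<Longrightarrow> R < \<bar>x\<bar> \<Longrightarrow> y = 0"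
    using initial_curve_bounded[OF assms(3,4)] by metis
  have "continuous_on UNIV (deriv f)"
    using assms(1) unfolding C2_def by (blast intro: differentiable_imp_continuous_on)
  then have "bounded (deriv f ` {-K..K})"
    by (intro compact_imp_bounded compact_continuous_image compact_Icc)
       (auto intro: continuous_on_subset)
  then obtain L where L: "L > 0" "\<And>y. \<bar>y\<bar> \<le> K \<Longrightarrow> \<bar>deriv f y\<bar> \<le> L"
    unfolding bounded_pos by (auto simp: abs_le_iff)
  show ?thesis
  proof (intro exI ballI impI)
    fix u assume u: "u \<in> Upsilon f h" "piecewise_smooth_shocks u" "integral_form_solution f u"
      "increasing_shocks u"
    have bound: "\<bar>u x t\<bar> \<le> K" if "t \<ge> 0" for x t
      by (rule KR(1)[OF Upsilon_characteristic[OF u(1) that]])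
    show "entropy_solution u K R L f"
    proof
      fix t :: real assume "t \<ge> 0"
      show "integrable lborel (\<lambda>x. u x t)"
        using u(1) \<open>t \<ge> 0\<close> unfolding Upsilon_def by blast
      fix x
      show "\<bar>u x t\<bar> \<le> K" by (rule bound[OF \<open>t \<ge> 0\<close>])
      assume "R + L * t < \<bar>x\<bar>"
      moreover have "\<bar>deriv f (u x t) * t\<bar> \<le> L * t"
        unfolding abs_mult using \<open>t \<ge> 0\<close> L bound by (intro mult_mono) auto
      \<comment> \<open>A characteristic moves at speed at most \<open>L\<close>, so its foot still
        lies outside the support of the initial curve.\<close>
      ultimately have "R < \<bar>x - deriv f (u x t) * t\<bar>" by linarith
      then show "u x t = 0" by (rule KR(2)[OF Upsilon_characteristic[OF u(1) \<open>t \<ge> 0\<close>]])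
    next
      show "0 \<le> L" using L(1) by simp
      show "f q \<le> f p + deriv f p * (q - p)" for p q
        by (rule strictly_concave_below_tangent[OF assms(1,2)])
      have "{x. \<not> continuous (at_right 0) (u x)} \<subseteq> {x. \<not> isCont h x}"
        using Upsilon_initial_trace[OF u(1) assms(3)] L(2) bound by blast
      then show "finite {x. \<not> continuous (at_right 0) (u x)}"
        by (rule finite_subset[OF _ piecewise_C1_finite_discontinuities[OF assms(3)]])
    qed (use u in auto)
  qed
qed

theorem proposition2p5:
  fixes f h :: "real \<Rightarrow> real" and u v :: "real \<Rightarrow> real \<Rightarrow> real"
  assumes "C2 f" and "strictly_concave f"
    and "piecewise_C1 h" and "compactly_supported h"
    and "u \<in> Upsilon f h" and "v \<in> Upsilon f h"
    and "piecewise_smooth_shocks u" and "piecewise_smooth_shocks v"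
    and "integral_form_solution f u" and "integral_form_solution f v"
    and "increasing_shocks u" and "increasing_shocks v"
    and "\<forall>x. u x 0 = v x 0"
  shows "\<forall>t>0. L1_norm (\<lambda>x. u x t - v x t) = 0"
proof (intro allI impI)
  fix t :: real assume "t > 0"
  obtain K R L where "entropy_solution u K R L f" "entropy_solution v K R L f"
    using Upsilon_entropy_solutions[OF assms(1-4)] assms(5-12) by metis
  then interpret u: entropy_solution u K R L f + v: entropy_solution v K R L f .
  have eq: "primitive u x t = primitive v x t" for x
    using primitive_comparison[OF u.entropy_solution_axioms v.entropy_solution_axioms]
      primitive_comparison[OF v.entropy_solution_axioms u.entropy_solution_axioms] assms(13) \<open>t > 0\<close>
    by (intro antisym) auto
  define N where "N = {x. (x, t) \<in> shocks u} \<union> {x. (x, t) \<in> shocks v}"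
  \<comment> \<open>Off the shocks both values are derivatives of the common primitive, and
    \<open>N\<close> is finite, hence null.\<close>
  have "u x t = v x t" if "x \<notin> N" for x
  proof (rule DERIV_unique)
    show "((\<lambda>y. primitive u y t) has_real_derivative u x t) (at x)"
      using that \<open>t > 0\<close> unfolding N_def by (intro u.primitive_has_derivative u.isCont_space) auto
    have "((\<lambda>y. primitive v y t) has_real_derivative v x t) (at x)"
      using that \<open>t > 0\<close> unfolding N_def by (intro v.primitive_has_derivative v.isCont_space) auto
    then show "((\<lambda>y. primitive u y t) has_real_derivative v x t) (at x)" by (simp add: eq)
  qed
  moreover have "AE x in lborel. x \<notin> N"
    unfolding N_def using u.finite_shocks_at v.finite_shocks_at
    by (intro AE_not_in countable_imp_null_set_lborel countable_finite finite_UnI)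
  ultimately have "AE x in lborel. ennreal \<bar>u x t - v x t\<bar> = 0" by (auto elim!: eventually_mono)
  then have "(\<integral>\<^sup>+x. ennreal \<bar>u x t - v x t\<bar> \<partial>lborel) = (\<integral>\<^sup>+x. 0 \<partial>(lborel :: real measure))"
    by (rule nn_integral_cong_AE)
  then show "L1_norm (\<lambda>x. u x t - v x t) = 0" unfolding L1_norm_def by simp
qed

end
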